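(* Let $\mathbf{A}=(A;\wedge,\vee,\neg,\to,0,\bot,\top)$ be an Fg-algebra, and put $\Diamond x:=x\wedge\top$ and $\Diamond(\mathbf{A}):=(\Diamond[A];\wedge,\vee,\to,0,\top)$. Then $\mathbf{A}$ is isomorphic to an Fg-twist-algebra over $\Diamond(\mathbf{A})$, as witnessed by the map $\iota\colon\mathbf{A}\to\Diamond(\mathbf{A})\times\Diamond(\mathbf{A})$, $a\mapsto(\Diamond a,\Diamond\neg a)$.
   Context: A De Morgan algebra is a bounded distributive lattice $(A;\wedge,\vee,0,1)$ with a unary operation $\neg$ satisfying $\neg\neg a=a$ and $\neg(a\wedge b)=\neg a\vee\neg b$ (so $1=\neg 0$). A DFg-algebra is an algebra $(A;\wedge,\vee,\neg,0,1,\bot,\top)$ such that $(A;\wedge,\vee,\neg,0,1)$ is a De Morgan algebra, $\neg\bot=\bot$, $\neg\top=\top$, and $\bot\wedge\top=0$. An Fg-algebra is a DFg-algebra expanded with a binary operation $\to$ satisfying, with $\Diamond x:=x\wedge\top$: (1) $x\wedge y=x\wedge(x\to y)$; (2) $x\to y\le(x\wedge y)\vee\top$; (3) $(x\wedge y)\to z=x\to(y\to z)$; (4) $\top\le x\to(y\to y)$; (5) $\top\le((x\to y)\to x)\to x$; (6) $\Diamond(x\to y)=\Diamond x\to\Diamond y$. $\Diamond(\mathbf{A})$ carries the operations of $\mathbf{A}$ restricted to $\Diamond[A]=\{a\wedge\top:a\in A\}$; it is a Boolean algebra with implication $\to$, least element $0$ and greatest element $\top$. For a Boolean algebra $\mathbf{B}$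 (with Boolean implication $\to$), the full Fg-twist-algebra $\mathbf{B}^{\bowtie}$ has universe $B\times B$ and operations $(x_1,x_2)\wedge(y_1,y_2):=(x_1\wedge y_1,x_2\vee y_2)$, $\neg(x_1,x_2):=(x_2,x_1)$, $\top:=(1,1)$, $\bot:=(0,0)$, $(x_1,x_2)\to(y_1,y_2):=(x_1\to y_1,x_2\vee y_2)$; moreover $x\vee y:=\neg(\neg x\wedge\neg y)$ and the lattice bottom is $(0,1)$. An Fg-twist-algebra over $\mathbf{B}$ is any subalgebra $\mathbf{C}\leqslant\mathbf{B}^{\bowtie}$ such that $\pi_1[C]=B$, where $\pi_1$ is the first projection. *)

theory Defs
  imports "HOL-Algebra.Congruence"
begin

text \<open>Algebras are records with an explicit carrier; operations are only constrained on it.\<close>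

record 'a lattice_struct = "'a partial_object" +
  meet :: "'a \<Rightarrow> 'a \<Rightarrow> 'a" (infixl "\<sqinter>\<index>" 70)
  join :: "'a \<Rightarrow> 'a \<Rightarrow> 'a" (infixl "\<squnion>\<index>" 65)
  zero :: 'a ("\<zero>\<index>")
  one :: 'a ("\<one>\<index>")

record 'a bool_struct = "'a lattice_struct" +
  bimp :: "'a \<Rightarrow> 'a \<Rightarrow> 'a" (infixr "\<rightharpoondown>\<index>" 60)

record 'a dm_struct = "'a lattice_struct" +
  neg :: "'a \<Rightarrow> 'a" ("\<sim>\<index> _" [81] 80)

record 'a dfg_struct = "'a dm_struct" +
  fgbot :: 'a ("\<bottom>\<index>")
  fgtop :: 'a ("\<top>\<index>")

record 'a fg_struct = "'a dfg_struct" +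
  imp :: "'a \<Rightarrow> 'a \<Rightarrow> 'a" (infixr "\<rightharpoonup>\<index>" 60)

definition lat_le :: "('a, 'b) lattice_struct_scheme \<Rightarrow> 'a \<Rightarrow> 'a \<Rightarrow> bool" (infix "\<sqsubseteq>\<index>" 50)
  where "x \<sqsubseteq>\<^bsub>L\<^esub> y \<longleftrightarrow> x \<sqinter>\<^bsub>L\<^esub> y = x"

locale bounded_distrib_lattice =
  fixes L (structure)
  assumes meet_closed: "\<lbrakk>x \<in> carrier L; y \<in> carrier L\<rbrakk> \<Longrightarrow> x \<sqinter> y \<in> carrier L"
    and join_closed: "\<lbrakk>x \<in> carrier L; y \<in> carrier L\<rbrakk> \<Longrightarrow> x \<squnion> y \<in> carrier L"
    and zero_closed: "\<zero> \<in> carrier L"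
    and one_closed: "\<one> \<in> carrier L"
    and meet_comm: "\<lbrakk>x \<in> carrier L; y \<in> carrier L\<rbrakk> \<Longrightarrow> x \<sqinter> y = y \<sqinter> x"
    and join_comm: "\<lbrakk>x \<in> carrier L; y \<in> carrier L\<rbrakk> \<Longrightarrow> x \<squnion> y = y \<squnion> x"
    and meet_assoc: "\<lbrakk>x \<in> carrier L; y \<in> carrier L; z \<in> carrier L\<rbrakk>
      \<Longrightarrow> (x \<sqinter> y) \<sqinter> z = x \<sqinter> (y \<sqinter> z)"
    and join_assoc: "\<lbrakk>x \<in> carrier L; y \<in> carrier L; z \<in> carrier L\<rbrakk>
      \<Longrightarrow> (x \<squnion> y) \<squnion> z = x \<squnion> (y \<squnion> z)"
    and meet_join_absorb: "\<lbrakk>x \<in> carrier L; y \<in> carrier L\<rbrakk> \<Longrightarrow> x \<sqinter> (x \<squnion> y) = x"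
    and join_meet_absorb: "\<lbrakk>x \<in> carrier L; y \<in> carrier L\<rbrakk> \<Longrightarrow> x \<squnion> (x \<sqinter> y) = x"
    and meet_join_distrib: "\<lbrakk>x \<in> carrier L; y \<in> carrier L; z \<in> carrier L\<rbrakk>
      \<Longrightarrow> x \<sqinter> (y \<squnion> z) = (x \<sqinter> y) \<squnion> (x \<sqinter> z)"
    and zero_least: "x \<in> carrier L \<Longrightarrow> \<zero> \<sqsubseteq> x"
    and one_greatest: "x \<in> carrier L \<Longrightarrow> x \<sqsubseteq> \<one>"

text \<open>Boolean algebras in the signature without complement: every element \<open>x\<close> has a complement
  \<open>c\<close>, and the implication is \<open>c \<squnion> y\<close>.\<close>

locale boolean_imp_algebra = bounded_distrib_lattice B for B (structure) +
  assumes complement_imp: "x \<in> carrier B \<Longrightarrow>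
    \<exists>c\<in>carrier B. x \<sqinter> c = \<zero> \<and> x \<squnion> c = \<one> \<and> (\<forall>y\<in>carrier B. x \<rightharpoondown> y = c \<squnion> y)"

locale de_morgan_algebra = bounded_distrib_lattice A for A (structure) +
  assumes neg_closed: "x \<in> carrier A \<Longrightarrow> \<sim> x \<in> carrier A"
    and neg_neg: "x \<in> carrier A \<Longrightarrow> \<sim> (\<sim> x) = x"
    and neg_meet: "\<lbrakk>x \<in> carrier A; y \<in> carrier A\<rbrakk> \<Longrightarrow> \<sim> (x \<sqinter> y) = \<sim> x \<squnion> \<sim> y"

locale dfg_algebra = de_morgan_algebra A for A (structure) +
  assumes bot_closed: "\<bottom> \<in> carrier A"
    and top_closed: "\<top> \<in> carrier A"
    and neg_bot: "\<sim> \<bottom> = \<bottom>"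
    and neg_top: "\<sim> \<top> = \<top>"
    and bot_meet_top: "\<bottom> \<sqinter> \<top> = \<zero>"

definition dia :: "('a, 'b) dfg_struct_scheme \<Rightarrow> 'a \<Rightarrow> 'a" ("\<diamond>\<index> _" [81] 80)
  where "\<diamond>\<^bsub>A\<^esub> x = x \<sqinter>\<^bsub>A\<^esub> \<top>\<^bsub>A\<^esub>"

locale fg_algebra = dfg_algebra A for A (structure) +
  assumes imp_closed: "\<lbrakk>x \<in> carrier A; y \<in> carrier A\<rbrakk> \<Longrightarrow> x \<rightharpoonup> y \<in> carrier A"
    and fg1: "\<lbrakk>x \<in> carrier A; y \<in> carrier A\<rbrakk> \<Longrightarrow> x \<sqinter> y = x \<sqinter> (x \<rightharpoonup> y)"
    and fg2: "\<lbrakk>x \<in> carrier A; y \<in> carrier A\<rbrakk> \<Longrightarrow> (x \<rightharpoonup> y) \<sqsubseteq> (x \<sqinter> y) \<squnion> \<top>"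
    and fg3: "\<lbrakk>x \<in> carrier A; y \<in> carrier A; z \<in> carrier A\<rbrakk>
      \<Longrightarrow> ((x \<sqinter> y) \<rightharpoonup> z) = (x \<rightharpoonup> (y \<rightharpoonup> z))"
    and fg4: "\<lbrakk>x \<in> carrier A; y \<in> carrier A\<rbrakk> \<Longrightarrow> \<top> \<sqsubseteq> (x \<rightharpoonup> (y \<rightharpoonup> y))"
    and fg5: "\<lbrakk>x \<in> carrier A; y \<in> carrier A\<rbrakk> \<Longrightarrow> \<top> \<sqsubseteq> (((x \<rightharpoonup> y) \<rightharpoonup> x) \<rightharpoonup> x)"
    and fg6: "\<lbrakk>x \<in> carrier A; y \<in> carrier A\<rbrakk> \<Longrightarrow> \<diamond> (x \<rightharpoonup> y) = (\<diamond> x \<rightharpoonup> \<diamond> y)"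

definition Dia :: "('a, 'b) fg_struct_scheme \<Rightarrow> 'a bool_struct"
  where "Dia A = \<lparr>carrier = dia A ` carrier A, meet = meet A, join = join A,
    zero = \<zero>\<^bsub>A\<^esub>, one = \<top>\<^bsub>A\<^esub>, bimp = imp A\<rparr>"

definition twist_meet :: "('b, 'c) bool_struct_scheme \<Rightarrow> 'b \<times> 'b \<Rightarrow> 'b \<times> 'b \<Rightarrow> 'b \<times> 'b"
  where "twist_meet B = (\<lambda>(x1, x2) (y1, y2). (x1 \<sqinter>\<^bsub>B\<^esub> y1, x2 \<squnion>\<^bsub>B\<^esub> y2))"

definition twist_neg :: "'b \<times> 'b \<Rightarrow> 'b \<times> 'b"
  where "twist_neg = (\<lambda>(x1, x2). (x2, x1))"

definition full_twist :: "('b, 'c) bool_struct_scheme \<Rightarrow> ('b \<times> 'b) fg_struct"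
  where "full_twist B =
   \<lparr>carrier = carrier B \<times> carrier B,
    meet = twist_meet B,
    join = (\<lambda>x y. twist_neg (twist_meet B (twist_neg x) (twist_neg y))),
    zero = (\<zero>\<^bsub>B\<^esub>, \<one>\<^bsub>B\<^esub>),
    one = twist_neg (\<zero>\<^bsub>B\<^esub>, \<one>\<^bsub>B\<^esub>),
    neg = twist_neg,
    fgbot = (\<zero>\<^bsub>B\<^esub>, \<zero>\<^bsub>B\<^esub>),
    fgtop = (\<one>\<^bsub>B\<^esub>, \<one>\<^bsub>B\<^esub>),
    imp = (\<lambda>(x1, x2) (y1, y2). (x1 \<rightharpoondown>\<^bsub>B\<^esub> y1, x2 \<squnion>\<^bsub>B\<^esub> y2))\<rparr>"

definition fg_hom :: "('a, 'c) fg_struct_scheme \<Rightarrow> ('b, 'd) fg_struct_scheme \<Rightarrow> ('a \<Rightarrow> 'b) set"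
  where "fg_hom A C = {h. h \<in> carrier A \<rightarrow> carrier C \<and>
    (\<forall>x\<in>carrier A. \<forall>y\<in>carrier A.
      h (x \<sqinter>\<^bsub>A\<^esub> y) = h x \<sqinter>\<^bsub>C\<^esub> h y \<and>
      h (x \<squnion>\<^bsub>A\<^esub> y) = h x \<squnion>\<^bsub>C\<^esub> h y \<and>
      h (x \<rightharpoonup>\<^bsub>A\<^esub> y) = (h x \<rightharpoonup>\<^bsub>C\<^esub> h y)) \<and>
    (\<forall>x\<in>carrier A. h (\<sim>\<^bsub>A\<^esub> x) = \<sim>\<^bsub>C\<^esub> (h x)) \<and>
    h \<zero>\<^bsub>A\<^esub> = \<zero>\<^bsub>C\<^esub> \<and> h \<one>\<^bsub>A\<^esub> = \<one>\<^bsub>C\<^esub> \<and> h \<bottom>\<^bsub>A\<^esub> = \<bottom>\<^bsub>C\<^esub> \<and> h \<top>\<^bsub>A\<^esub> = \<top>\<^bsub>C\<^esub>}"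

definition fg_iso :: "('a, 'c) fg_struct_scheme \<Rightarrow> ('b, 'd) fg_struct_scheme \<Rightarrow> ('a \<Rightarrow> 'b) set"
  where "fg_iso A C = {h \<in> fg_hom A C. bij_betw h (carrier A) (carrier C)}"

definition fg_subuniverse :: "'a set \<Rightarrow> ('a, 'c) fg_struct_scheme \<Rightarrow> bool"
  where "fg_subuniverse S D \<longleftrightarrow> S \<subseteq> carrier D \<and>
    (\<forall>x\<in>S. \<forall>y\<in>S. x \<sqinter>\<^bsub>D\<^esub> y \<in> S \<and> x \<squnion>\<^bsub>D\<^esub> y \<in> S \<and> (x \<rightharpoonup>\<^bsub>D\<^esub> y) \<in> S) \<and>
    (\<forall>x\<in>S. \<sim>\<^bsub>D\<^esub> x \<in> S) \<and>
    \<zero>\<^bsub>D\<^esub> \<in> S \<and> \<one>\<^bsub>D\<^esub> \<in> S \<and> \<bottom>\<^bsub>D\<^esub> \<in> S \<and> \<top>\<^bsub>D\<^esub> \<in> S"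

definition fg_subalgebra :: "'a fg_struct \<Rightarrow> 'a fg_struct \<Rightarrow> bool"
  where "fg_subalgebra C D \<longleftrightarrow> (\<exists>S. fg_subuniverse S D \<and> C = D\<lparr>carrier := S\<rparr>)"

definition fg_twist_algebra :: "('b, 'c) bool_struct_scheme \<Rightarrow> ('b \<times> 'b) fg_struct \<Rightarrow> bool"
  where "fg_twist_algebra B C \<longleftrightarrow>
    boolean_imp_algebra B \<and> fg_subalgebra C (full_twist B) \<and> fst ` carrier C = carrier B"

definition iota :: "('a, 'b) fg_struct_scheme \<Rightarrow> 'a \<Rightarrow> 'a \<times> 'a"
  where "iota A a = (\<diamond>\<^bsub>A\<^esub> a, \<diamond>\<^bsub>A\<^esub> (\<sim>\<^bsub>A\<^esub> a))"

end

theory Submission imports Defs begin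

text \<open>
  Below \<open>\<top>\<close>, the element \<open>\<top> \<rightharpoonup> y\<close> equals \<open>y\<close>, so \<open>fg4\<close> says that every \<open>y \<rightharpoonup> y\<close> is
  \<open>\<top>\<close> there. Together with \<open>fg1\<close> and the currying law \<open>fg3\<close> this makes \<open>\<rightharpoonup>\<close> the residual of
  \<open>\<sqinter>\<close> on \<open>\<diamond>[A]\<close> (lemma \<open>residuation\<close>), which is therefore a Heyting algebra; \<open>fg5\<close> is
  then Peirce's law and turns it into a Boolean algebra, with complement \<open>x \<rightharpoonup> \<zero>\<close> (lemma
  \<open>boolean_Dia\<close>).

  The first coordinate of \<open>iota A\<close> respects meet, join and implication by distributivity and
  \<open>fg6\<close>. For the second, \<open>\<sim> \<top> = \<top>\<close> and De Morgan duality turn \<open>\<diamond> (\<sim> a)\<close> into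
  \<open>\<sim> (a \<squnion> \<top>)\<close>. From this point of view \<open>fg1\<close> and \<open>fg2\<close> together say that \<open>x \<rightharpoonup> y\<close> and
  \<open>x \<sqinter> y\<close> have the same join with \<open>\<top>\<close> (lemma \<open>imp_join_top\<close>), which is why the second
  coordinate of an implication is computed like that of a meet. Injectivity is the cancellation
  law of distributive lattices: \<open>a \<sqinter> \<top>\<close> and \<open>a \<squnion> \<top>\<close> determine \<open>a\<close>. The twist-algebra is
  then the image of \<open>iota A\<close>.
\<close>

section \<open>Order and cancellation in bounded distributive lattices\<close>

context bounded_distrib_lattice
begin

lemma meet_idem: "x \<in> carrier L \<Longrightarrow> x \<sqinter> x = x"
  by (metis join_meet_absorb meet_closed meet_join_absorb)

lemma le_refl: "x \<in> carrier L \<Longrightarrow> x \<sqsubseteq> x"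
  by (simp add: lat_le_def meet_idem)

lemma le_antisym: "\<lbrakk>x \<in> carrier L; y \<in> carrier L; x \<sqsubseteq> y; y \<sqsubseteq> x\<rbrakk> \<Longrightarrow> x = y"
  by (metis lat_le_def meet_comm)

lemma le_trans:
  assumes "x \<in> carrier L" "y \<in> carrier L" "z \<in> carrier L" "x \<sqsubseteq> y" "y \<sqsubseteq> z"
  shows "x \<sqsubseteq> z"
  using assms by (metis lat_le_def meet_assoc)

lemma meet_le2: "\<lbrakk>x \<in> carrier L; y \<in> carrier L\<rbrakk> \<Longrightarrow> x \<sqinter> y \<sqsubseteq> y"
  by (simp add: lat_le_def meet_assoc meet_idem meet_closed)

lemma meet_le1: "\<lbrakk>x \<in> carrier L; y \<in> carrier L\<rbrakk> \<Longrightarrow> x \<sqinter> y \<sqsubseteq> x"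
  using meet_le2 [of y x] by (simp add: meet_comm)

lemma le_join1: "\<lbrakk>x \<in> carrier L; y \<in> carrier L\<rbrakk> \<Longrightarrow> x \<sqsubseteq> x \<squnion> y"
  by (simp add: lat_le_def meet_join_absorb)

lemma le_join2: "\<lbrakk>x \<in> carrier L; y \<in> carrier L\<rbrakk> \<Longrightarrow> y \<sqsubseteq> x \<squnion> y"
  using le_join1 [of y x] by (simp add: join_comm)

lemma le_iff_join: "\<lbrakk>x \<in> carrier L; y \<in> carrier L\<rbrakk> \<Longrightarrow> x \<sqsubseteq> y \<longleftrightarrow> x \<squnion> y = y"
  by (metis join_comm join_meet_absorb lat_le_def meet_comm meet_join_absorb)

lemma join_least:
  assumes "x \<in> carrier L" "y \<in> carrier L" "z \<in> carrier L" "x \<sqsubseteq> z" "y \<sqsubseteq> z"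
  shows "x \<squnion> y \<sqsubseteq> z"
  using assms by (simp add: le_iff_join join_assoc join_closed)

lemma meet_mono_left:
  assumes "x \<in> carrier L" "y \<in> carrier L" "z \<in> carrier L" "x \<sqsubseteq> y"
  shows "z \<sqinter> x \<sqsubseteq> z \<sqinter> y"
proof -
  have "z \<sqinter> y = (z \<sqinter> x) \<squnion> (z \<sqinter> y)"
    using assms by (metis le_iff_join meet_join_distrib)
  then show ?thesis
    using assms by (metis le_join1 meet_closed)
qed

lemma join_meet_distrib_right:
  assumes "x \<in> carrier L" "y \<in> carrier L" "z \<in> carrier L"
  shows "(x \<squnion> y) \<sqinter> z = (x \<sqinter> z) \<squnion> (y \<sqinter> z)"
  using assms by (metis join_closed meet_comm meet_join_distrib)

lemma meet_meet_distrib_right: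
  assumes "x \<in> carrier L" "y \<in> carrier L" "z \<in> carrier L"
  shows "(x \<sqinter> y) \<sqinter> z = (x \<sqinter> z) \<sqinter> (y \<sqinter> z)"
  using assms by (metis meet_assoc meet_closed meet_comm meet_idem)

lemma distrib_cancel:
  assumes "x \<in> carrier L" "y \<in> carrier L" "z \<in> carrier L"
    and meet: "x \<sqinter> z = y \<sqinter> z" and join: "x \<squnion> z = y \<squnion> z"
  shows "x = y"
proof -
  have "x = x \<sqinter> (y \<squnion> z)"
    using assms by (metis meet_join_absorb)
  also have "\<dots> = (y \<sqinter> x) \<squnion> (y \<sqinter> z)"
    using assms by (simp add: meet_join_distrib meet_comm)
  also have "\<dots> = y \<sqinter> (x \<squnion> z)"
    using assms(1-3) by (simp add: meet_join_distrib)
  also have "\<dots> = y"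
    using assms by (metis meet_join_absorb)
  finally show ?thesis .
qed

end

section \<open>Duality in De Morgan and DFg-algebras\<close>

lemma (in de_morgan_algebra) neg_join:
  assumes "x \<in> carrier A" "y \<in> carrier A"
  shows "\<sim> (x \<squnion> y) = \<sim> x \<sqinter> \<sim> y"
  using assms by (metis meet_closed neg_closed neg_meet neg_neg)

lemma (in de_morgan_algebra) neg_zero: "\<sim> \<zero> = \<one>"
proof -
  have "\<zero> \<sqinter> \<sim> \<one> = \<zero>"
    using zero_least [of "\<sim> \<one>"] by (simp add: lat_le_def neg_closed one_closed)
  then have "\<sim> \<zero> \<squnion> \<one> = \<sim> \<zero>"
    by (metis neg_closed neg_meet neg_neg one_closed zero_closed)
  then have "\<one> \<sqsubseteq> \<sim> \<zero>"
    by (metis le_join2 neg_closed one_closed zero_closed)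
  then show ?thesis
    by (simp add: le_antisym neg_closed one_closed one_greatest zero_closed)
qed

context dfg_algebra
begin

lemma dia_closed: "x \<in> carrier A \<Longrightarrow> \<diamond> x \<in> carrier A"
  by (simp add: dia_def meet_closed top_closed)

lemma dia_meet: "\<lbrakk>x \<in> carrier A; y \<in> carrier A\<rbrakk> \<Longrightarrow> \<diamond> (x \<sqinter> y) = \<diamond> x \<sqinter> \<diamond> y"
  unfolding dia_def by (rule meet_meet_distrib_right) (simp_all add: top_closed)

lemma dia_join: "\<lbrakk>x \<in> carrier A; y \<in> carrier A\<rbrakk> \<Longrightarrow> \<diamond> (x \<squnion> y) = \<diamond> x \<squnion> \<diamond> y"
  unfolding dia_def by (rule join_meet_distrib_right) (simp_all add: top_closed)

lemma dia_image_iff: "x \<in> dia A ` carrier A \<longleftrightarrow> x \<in> carrier A \<and> x \<sqsubseteq> \<top>"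
proof
  assume "x \<in> dia A ` carrier A"
  then show "x \<in> carrier A \<and> x \<sqsubseteq> \<top>"
    by (auto simp: dia_closed) (simp add: dia_def meet_le2 top_closed)
next
  assume "x \<in> carrier A \<and> x \<sqsubseteq> \<top>"
  then have "x = \<diamond> x" "x \<in> carrier A"
    by (simp_all add: dia_def lat_le_def)
  then show "x \<in> dia A ` carrier A"
    by (rule image_eqI)
qed

text \<open>
  As \<open>\<top>\<close> is self-dual, \<open>\<diamond> (\<sim> x)\<close> and \<open>x \<squnion> \<top>\<close> are exchanged by the involution, so each
  determines the other.
\<close>

lemma dia_neg: "x \<in> carrier A \<Longrightarrow> \<diamond> (\<sim> x) = \<sim> (x \<squnion> \<top>)"
  by (simp add: dia_def neg_join neg_top top_closed)

lemma dia_neg_eq_iff: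
  assumes "x \<in> carrier A" "y \<in> carrier A"
  shows "\<diamond> (\<sim> x) = \<diamond> (\<sim> y) \<longleftrightarrow> x \<squnion> \<top> = y \<squnion> \<top>"
  using assms by (metis dia_neg join_closed neg_neg top_closed)

end

section \<open>The Boolean algebra below \<open>\<top>\<close>\<close>

context fg_algebra
begin

lemma imp_below:
  assumes "x \<in> carrier A" "x \<sqsubseteq> \<top>" "y \<in> carrier A" "y \<sqsubseteq> \<top>"
  shows "(x \<rightharpoonup> y) \<sqsubseteq> \<top>"
proof -
  have "\<diamond> x = x" "\<diamond> y = y"
    using assms by (simp_all add: dia_def lat_le_def)
  then have "\<diamond> (x \<rightharpoonup> y) = (x \<rightharpoonup> y)"
    using assms by (simp add: fg6)
  then show ?thesis
    by (simp add: dia_def lat_le_def)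
qed

lemma top_imp:
  assumes "y \<in> carrier A" "y \<sqsubseteq> \<top>"
  shows "(\<top> \<rightharpoonup> y) = y"
proof -
  have "(\<top> \<rightharpoonup> y) \<sqsubseteq> \<top>"
    using assms by (simp add: imp_below top_closed le_refl)
  then have "(\<top> \<rightharpoonup> y) = \<top> \<sqinter> (\<top> \<rightharpoonup> y)"
    using assms by (metis imp_closed lat_le_def meet_comm top_closed)
  also have "\<dots> = y"
    using assms by (metis fg1 lat_le_def meet_comm top_closed)
  finally show ?thesis .
qed

lemma imp_imp_self:
  assumes "x \<in> carrier A" "x \<sqsubseteq> \<top>" "y \<in> carrier A" "y \<sqsubseteq> \<top>"
  shows "(x \<rightharpoonup> (y \<rightharpoonup> y)) = \<top>"
  using assms by (intro le_antisym fg4 imp_below imp_closed top_closed)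

text \<open>
  For the backward direction, \<open>x \<sqsubseteq> y\<close> rewrites \<open>x \<rightharpoonup> y\<close> to \<open>(x \<sqinter> y) \<rightharpoonup> y\<close>, which currying
  sends to \<open>x \<rightharpoonup> (y \<rightharpoonup> y)\<close>.
\<close>

lemma imp_eq_top_iff:
  assumes "x \<in> carrier A" "x \<sqsubseteq> \<top>" "y \<in> carrier A" "y \<sqsubseteq> \<top>"
  shows "(x \<rightharpoonup> y) = \<top> \<longleftrightarrow> x \<sqsubseteq> y"
proof
  assume "(x \<rightharpoonup> y) = \<top>"
  then show "x \<sqsubseteq> y"
    using assms fg1 [of x y] by (simp add: lat_le_def)
next
  assume "x \<sqsubseteq> y"
  then have "(x \<rightharpoonup> y) = ((x \<sqinter> y) \<rightharpoonup> y)"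
    by (simp add: lat_le_def)
  also have "\<dots> = \<top>"
    using assms by (simp add: fg3 imp_imp_self)
  finally show "(x \<rightharpoonup> y) = \<top>" .
qed

lemma residuation:
  assumes "x \<in> carrier A" "x \<sqsubseteq> \<top>" "y \<in> carrier A" "y \<sqsubseteq> \<top>" "z \<in> carrier A" "z \<sqsubseteq> \<top>"
  shows "z \<sqsubseteq> (x \<rightharpoonup> y) \<longleftrightarrow> z \<sqinter> x \<sqsubseteq> y"
proof -
  have "z \<sqinter> x \<sqsubseteq> \<top>"
    using assms by (meson le_trans meet_closed meet_le2 top_closed)
  then have "z \<sqinter> x \<sqsubseteq> y \<longleftrightarrow> ((z \<sqinter> x) \<rightharpoonup> y) = \<top>"
    using assms by (simp add: imp_eq_top_iff meet_closed)
  also have "\<dots> \<longleftrightarrow> z \<sqsubseteq> (x \<rightharpoonup> y)"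
    using assms by (simp add: fg3 imp_eq_top_iff imp_below imp_closed)
  finally show ?thesis ..
qed

lemma zero_below_top: "\<zero> \<sqsubseteq> \<top>"
  by (simp add: zero_least top_closed)

lemma meet_pseudocomplement: "x \<in> carrier A \<Longrightarrow> x \<sqinter> (x \<rightharpoonup> \<zero>) = \<zero>"
  using fg1 [of x \<zero>] zero_least [of x] by (simp add: lat_le_def meet_comm zero_closed)

text \<open>
  Let \<open>w\<close> be the join of \<open>x\<close> with its pseudocomplement. The pseudocomplement of \<open>w\<close> lies below
  that of \<open>x\<close>, hence below \<open>w\<close> itself, and Peirce's law for \<open>w\<close> and \<open>\<zero>\<close> then yields
  \<open>w = \<top>\<close>.
\<close>

lemma join_pseudocomplement:
  assumes x: "x \<in> carrier A" "x \<sqsubseteq> \<top>"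
  shows "x \<squnion> (x \<rightharpoonup> \<zero>) = \<top>"
proof -
  define w where "w = x \<squnion> (x \<rightharpoonup> \<zero>)"
  have xc: "(x \<rightharpoonup> \<zero>) \<in> carrier A" "(x \<rightharpoonup> \<zero>) \<sqsubseteq> \<top>"
    using x by (simp_all add: imp_closed imp_below zero_closed zero_below_top)
  have w: "w \<in> carrier A" "w \<sqsubseteq> \<top>"
    using x xc by (simp_all add: w_def join_closed join_least top_closed)
  have wc: "(w \<rightharpoonup> \<zero>) \<in> carrier A" "(w \<rightharpoonup> \<zero>) \<sqsubseteq> \<top>"
    using w by (simp_all add: imp_closed imp_below zero_closed zero_below_top)
  have "(w \<rightharpoonup> \<zero>) \<sqinter> x \<sqsubseteq> (w \<rightharpoonup> \<zero>) \<sqinter> w"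
    using x xc wc w by (simp add: meet_mono_left w_def le_join1)
  also have "(w \<rightharpoonup> \<zero>) \<sqinter> w = \<zero>"
    using w wc by (simp add: meet_comm meet_pseudocomplement)
  finally have "(w \<rightharpoonup> \<zero>) \<sqsubseteq> (x \<rightharpoonup> \<zero>)"
    using x wc by (simp add: residuation zero_closed zero_below_top)
  moreover have "(x \<rightharpoonup> \<zero>) \<sqsubseteq> w"
    using x xc by (simp add: w_def le_join2)
  ultimately have "(w \<rightharpoonup> \<zero>) \<sqsubseteq> w"
    using w wc xc by (meson le_trans)
  then have "((w \<rightharpoonup> \<zero>) \<rightharpoonup> w) = \<top>"
    using w wc by (simp add: imp_eq_top_iff)
  then have "\<top> \<sqsubseteq> (\<top> \<rightharpoonup> w)"
    using fg5 [of w \<zero>] w by (simp add: zero_closed)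
  then show ?thesis
    using w by (simp add: top_imp le_antisym top_closed flip: w_def)
qed

text \<open>
  The implication is cut along \<open>x \<squnion> (x \<rightharpoonup> \<zero>) = \<top>\<close>: its part in \<open>x\<close> is \<open>x \<sqinter> y\<close>, and its
  other part lies in \<open>x \<rightharpoonup> \<zero>\<close>. The converse inequality is residuation.
\<close>

lemma imp_eq_join:
  assumes "x \<in> carrier A" "x \<sqsubseteq> \<top>" "y \<in> carrier A" "y \<sqsubseteq> \<top>"
  shows "(x \<rightharpoonup> y) = (x \<rightharpoonup> \<zero>) \<squnion> y"
proof (rule le_antisym)
  have xc: "(x \<rightharpoonup> \<zero>) \<in> carrier A" "(x \<rightharpoonup> \<zero>) \<sqsubseteq> \<top>"
    using assms by (simp_all add: imp_closed imp_below zero_closed zero_below_top)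
  have xy: "(x \<rightharpoonup> y) \<in> carrier A" "(x \<rightharpoonup> y) \<sqsubseteq> \<top>"
    using assms by (simp_all add: imp_closed imp_below)
  show "(x \<rightharpoonup> y) \<in> carrier A" "(x \<rightharpoonup> \<zero>) \<squnion> y \<in> carrier A"
    using assms xc xy by (simp_all add: join_closed)
  have "(x \<rightharpoonup> y) = (x \<rightharpoonup> y) \<sqinter> (x \<squnion> (x \<rightharpoonup> \<zero>))"
    using assms xy by (simp add: join_pseudocomplement lat_le_def)
  also have "\<dots> = (x \<sqinter> y) \<squnion> ((x \<rightharpoonup> y) \<sqinter> (x \<rightharpoonup> \<zero>))"
    using assms xc xy by (simp add: meet_join_distrib meet_comm [of "x \<rightharpoonup> y" x] fg1 [of x y])
  also have "\<dots> \<sqsubseteq> (x \<rightharpoonup> \<zero>) \<squnion> y"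
  proof (rule join_least)
    show "x \<sqinter> y \<sqsubseteq> (x \<rightharpoonup> \<zero>) \<squnion> y"
      using assms xc by (meson join_closed le_join2 le_trans meet_closed meet_le2)
    show "(x \<rightharpoonup> y) \<sqinter> (x \<rightharpoonup> \<zero>) \<sqsubseteq> (x \<rightharpoonup> \<zero>) \<squnion> y"
      using assms xc xy by (meson join_closed le_join1 le_trans meet_closed meet_le2)
  qed (use assms xc xy in \<open>simp_all add: meet_closed join_closed\<close>)
  finally show "(x \<rightharpoonup> y) \<sqsubseteq> (x \<rightharpoonup> \<zero>) \<squnion> y" .
  have "(x \<rightharpoonup> \<zero>) \<sqsubseteq> (x \<rightharpoonup> y)"
    using assms xc by (simp add: residuation meet_comm [of "x \<rightharpoonup> \<zero>" x] meet_pseudocomplement zero_least)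
  moreover have "y \<sqsubseteq> (x \<rightharpoonup> y)"
    using assms by (simp add: residuation meet_le1)
  ultimately show "(x \<rightharpoonup> \<zero>) \<squnion> y \<sqsubseteq> (x \<rightharpoonup> y)"
    using assms xc xy by (simp add: join_least)
qed

lemma Dia_simps:
  "carrier (Dia A) = {x \<in> carrier A. x \<sqsubseteq> \<top>}" "meet (Dia A) = meet A" "join (Dia A) = join A"
  "\<zero>\<^bsub>Dia A\<^esub> = \<zero>" "\<one>\<^bsub>Dia A\<^esub> = \<top>" "bimp (Dia A) = imp A"
  using dia_image_iff by (auto simp: Dia_def)

lemma dia_in_Dia: "x \<in> carrier A \<Longrightarrow> \<diamond> x \<in> carrier (Dia A)"
  by (simp add: Dia_def)

lemma boolean_Dia: "boolean_imp_algebra (Dia A)"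
proof
  show "x \<sqinter>\<^bsub>Dia A\<^esub> y \<in> carrier (Dia A)" if "x \<in> carrier (Dia A)" "y \<in> carrier (Dia A)" for x y
    using that by (simp add: Dia_simps meet_closed) (meson le_trans meet_closed meet_le2 top_closed)
  show "x \<squnion>\<^bsub>Dia A\<^esub> y \<in> carrier (Dia A)" if "x \<in> carrier (Dia A)" "y \<in> carrier (Dia A)" for x y
    using that by (simp add: Dia_simps join_closed join_least top_closed)
  show "\<exists>c\<in>carrier (Dia A). x \<sqinter>\<^bsub>Dia A\<^esub> c = \<zero>\<^bsub>Dia A\<^esub> \<and> x \<squnion>\<^bsub>Dia A\<^esub> c = \<one>\<^bsub>Dia A\<^esub> \<and>
      (\<forall>y\<in>carrier (Dia A). (x \<rightharpoondown>\<^bsub>Dia A\<^esub> y) = c \<squnion>\<^bsub>Dia A\<^esub> y)" if "x \<in> carrier (Dia A)" for x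
  proof (rule bexI [where x = "x \<rightharpoonup> \<zero>"])
    show "(x \<rightharpoonup> \<zero>) \<in> carrier (Dia A)"
      using that by (simp add: Dia_simps imp_closed imp_below zero_closed zero_below_top)
  qed (use that in \<open>auto simp: Dia_simps meet_pseudocomplement join_pseudocomplement
    intro: imp_eq_join\<close>)
qed (auto simp: Dia_simps top_closed zero_closed meet_idem zero_below_top
    meet_join_absorb join_meet_absorb meet_join_distrib meet_assoc join_assoc lat_le_def
    intro: meet_comm join_comm zero_least [unfolded lat_le_def])

section \<open>The embedding into the full twist-algebra\<close>

text \<open>
  Here \<open>fg2\<close> bounds the join of \<open>x \<rightharpoonup> y\<close> with \<open>\<top>\<close> from above, while \<open>fg1\<close> gives
  \<open>x \<sqinter> y \<sqsubseteq> x \<rightharpoonup> y\<close> and so bounds it from below.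
\<close>

lemma imp_join_top:
  assumes "x \<in> carrier A" "y \<in> carrier A"
  shows "(x \<rightharpoonup> y) \<squnion> \<top> = (x \<sqinter> y) \<squnion> \<top>"
proof (rule le_antisym)
  have cl: "x \<sqinter> y \<in> carrier A" "(x \<rightharpoonup> y) \<in> carrier A"
    using assms by (simp_all add: meet_closed imp_closed)
  show "(x \<rightharpoonup> y) \<squnion> \<top> \<in> carrier A" "(x \<sqinter> y) \<squnion> \<top> \<in> carrier A"
    using cl by (simp_all add: join_closed top_closed)
  show "(x \<rightharpoonup> y) \<squnion> \<top> \<sqsubseteq> (x \<sqinter> y) \<squnion> \<top>"
    using assms cl by (simp add: join_least fg2 le_join2 join_closed top_closed)
  have "x \<sqinter> y \<sqsubseteq> (x \<rightharpoonup> y)"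
    using assms cl by (metis fg1 meet_le2)
  then have "x \<sqinter> y \<sqsubseteq> (x \<rightharpoonup> y) \<squnion> \<top>"
    using cl by (meson join_closed le_join1 le_trans top_closed)
  then show "(x \<sqinter> y) \<squnion> \<top> \<sqsubseteq> (x \<rightharpoonup> y) \<squnion> \<top>"
    using cl by (simp add: join_least le_join2 join_closed top_closed)
qed

lemma dia_neg_imp:
  assumes "x \<in> carrier A" "y \<in> carrier A"
  shows "\<diamond> (\<sim> (x \<rightharpoonup> y)) = \<diamond> (\<sim> x) \<squnion> \<diamond> (\<sim> y)"
proof -
  have "\<diamond> (\<sim> (x \<rightharpoonup> y)) = \<diamond> (\<sim> (x \<sqinter> y))"
    using assms by (simp add: dia_neg_eq_iff imp_join_top imp_closed meet_closed)
  then show ?thesis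
    using assms by (simp add: neg_meet dia_join neg_closed)
qed

lemma iota_hom: "iota A \<in> fg_hom A (full_twist (Dia A))"
proof -
  have constants: "\<diamond> \<zero> = \<zero>" "\<diamond> \<one> = \<top>" "\<diamond> \<bottom> = \<zero>" "\<diamond> \<top> = \<top>" "\<sim> \<one> = \<zero>"
    using zero_least [of \<top>] one_greatest [of \<top>] neg_neg [of \<zero>]
    by (simp_all add: dia_def lat_le_def bot_meet_top meet_idem top_closed zero_closed
        one_closed neg_zero meet_comm [of \<one> \<top>])
  show ?thesis
    unfolding fg_hom_def
    by (auto simp: full_twist_def iota_def twist_meet_def twist_neg_def dia_in_Dia Dia_simps(2-6)
        neg_closed dia_meet dia_join neg_meet neg_join neg_neg fg6 dia_neg_imp constants
        neg_zero neg_bot neg_top)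
qed

lemma iota_inj: "inj_on (iota A) (carrier A)"
proof (rule inj_onI)
  fix x y
  assume xy: "x \<in> carrier A" "y \<in> carrier A" and "iota A x = iota A y"
  then have "x \<sqinter> \<top> = y \<sqinter> \<top>" "x \<squnion> \<top> = y \<squnion> \<top>"
    by (auto simp: iota_def dia_neg_eq_iff) (simp add: dia_def)
  with xy show "x = y"
    by (intro distrib_cancel [of x y \<top>]) (simp_all add: top_closed)
qed

end

lemma fg_hom_image_subuniverse:
  assumes A: "fg_algebra A" and h: "h \<in> fg_hom A D"
  shows "fg_subuniverse (h ` carrier A) D"
proof -
  interpret fg_algebra A by (rule A)
  have binary: "h x \<sqinter>\<^bsub>D\<^esub> h y \<in> h ` carrier A" "h x \<squnion>\<^bsub>D\<^esub> h y \<in> h ` carrier A"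
    "(h x \<rightharpoonup>\<^bsub>D\<^esub> h y) \<in> h ` carrier A" if "x \<in> carrier A" "y \<in> carrier A" for x y
    using that h imageI [of "x \<sqinter>\<^bsub>A\<^esub> y" "carrier A" h] imageI [of "x \<squnion>\<^bsub>A\<^esub> y" "carrier A" h]
      imageI [of "x \<rightharpoonup>\<^bsub>A\<^esub> y" "carrier A" h]
    by (simp_all add: fg_hom_def meet_closed join_closed imp_closed)
  have unary: "\<sim>\<^bsub>D\<^esub> (h x) \<in> h ` carrier A" if "x \<in> carrier A" for x
    using that h imageI [of "\<sim>\<^bsub>A\<^esub> x" "carrier A" h] by (simp add: fg_hom_def neg_closed)
  have constants: "\<zero>\<^bsub>D\<^esub> \<in> h ` carrier A" "\<one>\<^bsub>D\<^esub> \<in> h ` carrier A" "\<bottom>\<^bsub>D\<^esub> \<in> h ` carrier A"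
    "\<top>\<^bsub>D\<^esub> \<in> h ` carrier A"
    using h imageI [OF zero_closed, of h] imageI [OF one_closed, of h]
      imageI [OF bot_closed, of h] imageI [OF top_closed, of h]
    by (simp_all add: fg_hom_def)
  have "h ` carrier A \<subseteq> carrier D"
    using h by (auto simp: fg_hom_def)
  with binary unary constants show ?thesis
    by (auto simp: fg_subuniverse_def)
qed

lemma fg_hom_onto_image:
  "h \<in> fg_hom A D \<Longrightarrow> h \<in> fg_hom A (D\<lparr>carrier := h ` carrier A\<rparr>)"
  by (simp add: fg_hom_def)

theorem theorem52:
  fixes A :: "'a fg_struct"
  assumes "fg_algebra A"
  shows "\<exists>C. fg_twist_algebra (Dia A) C \<and> iota A \<in> fg_iso A C"
proof -
  interpret fg_algebra A by (rule assms)
  define C where "C = (full_twist (Dia A))\<lparr>carrier := iota A ` carrier A\<rparr>"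
  have "fg_subalgebra C (full_twist (Dia A))"
    unfolding fg_subalgebra_def C_def
    using fg_hom_image_subuniverse [OF assms iota_hom] by blast
  moreover have "fst ` carrier C = carrier (Dia A)"
    by (simp add: C_def Dia_def image_image iota_def)
  ultimately have "fg_twist_algebra (Dia A) C"
    by (simp add: fg_twist_algebra_def boolean_Dia)
  moreover have "iota A \<in> fg_iso A C"
    using fg_hom_onto_image [OF iota_hom] iota_inj
    by (simp add: fg_iso_def C_def inj_on_imp_bij_betw)
  ultimately show ?thesis
    by blast
qed

end
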